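(* Let $S:\mathbb{R}^m\rightrightarrows\mathbb{R}^n$ be a polyhedral set-valued map. Then there exists a number $\kappa>0$ such that for every $\bar y\in\mathrm{dom}\,S$, $S$ is inner calm* with constant $\kappa$ with respect to $\mathrm{dom}\,S$ at $\bar y$, as well as calm with constant $\kappa$ at $\bar y$ in the (non-localized) sense that \[S(y)\subset S(\bar y)+\kappa\|y-\bar y\|\mathcal{B}\] holds for all $y$ near $\bar y$.
   Context: $\mathcal{B}$ is the closed unit ball, $\mathrm{gph}\,S=\{(y,x): x\in S(y)\}$ and $\mathrm{dom}\,S=\{y: S(y)\neq\emptyset\}$. A set is convex polyhedral if it is the intersection of finitely many halfspaces, and polyhedral if it is a union of finitely many convex polyhedral sets. A set-valued map is polyhedral if its graph is a polyhedral set. $S$ is inner calm* at $\bar y$ with respect to $\Omega\subset\mathbb{R}^m$ with constant $\kappa$ if for every sequence $y_k\to\bar y$ with $y_k\in\Omega$ there exist an infinite subset (subsequence) $K$ of $\mathbb{N}$, a sequence $(x_k)_{k\in K}$ and a point $\bar x\in\mathbb{R}^n$ (these may depend on the sequence $(y_k)$) with $x_k\in S(y_k)$ and $\|x_k-\bar x\|\le\kappa\|y_k-\bar y\|$ for all $k\in K$. *)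

theory Defs
  imports "HOL-Analysis.Analysis"
begin

text \<open>A set-valued map from Y to X is a function of type Y to X set; the value may be empty.\<close>

definition gph :: "('a \<Rightarrow> 'b set) \<Rightarrow> ('a \<times> 'b) set" where
  "gph S = {(y, x). x \<in> S y}"

definition svdom :: "('a \<Rightarrow> 'b set) \<Rightarrow> 'a set" where
  "svdom S = {y. S y \<noteq> {}}"

text \<open>Convex polyhedral sets are the \<^const>\<open>polyhedron\<close> sets of the library: intersections of
  finitely many closed halfspaces. The empty union is admitted.\<close>

definition polyhedral_set :: "'a::euclidean_space set \<Rightarrow> bool" where
  "polyhedral_set C \<longleftrightarrow> (\<exists>F. finite F \<and> (\<forall>P\<in>F. polyhedron P) \<and> C = \<Union>F)"

definition polyhedral_map :: "('a::euclidean_space \<Rightarrow> 'b::euclidean_space set) \<Rightarrow> bool" where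
  "polyhedral_map S \<longleftrightarrow> polyhedral_set (gph S)"

text \<open>The partial sequence indexed by \<open>K\<close> is encoded by a total \<open>x\<close> of which only the values
  on \<open>K\<close> matter.\<close>

definition inner_calm_star ::
  "('a::real_normed_vector \<Rightarrow> 'b::real_normed_vector set) \<Rightarrow> 'a set \<Rightarrow> real \<Rightarrow> 'a \<Rightarrow> bool" where
  "inner_calm_star S \<Omega> \<kappa> ybar \<longleftrightarrow>
     (\<forall>y::nat \<Rightarrow> 'a. (\<forall>k. y k \<in> \<Omega>) \<and> y \<longlonglongrightarrow> ybar \<longrightarrow>
        (\<exists>(K::nat set) (x::nat \<Rightarrow> 'b) xbar. infinite K \<and>
           (\<forall>k\<in>K. x k \<in> S (y k) \<and> norm (x k - xbar) \<le> \<kappa> * norm (y k - ybar))))"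

text \<open>Non-localized calmness (also known as the upper Lipschitz property).\<close>

definition calm_nonlocal ::
  "('a::real_normed_vector \<Rightarrow> 'b::real_normed_vector set) \<Rightarrow> real \<Rightarrow> 'a \<Rightarrow> bool" where
  "calm_nonlocal S \<kappa> ybar \<longleftrightarrow>
     (\<forall>\<^sub>F y in nhds ybar. S y \<subseteq> S ybar + (\<lambda>b. (\<kappa> * norm (y - ybar)) *\<^sub>R b) ` cball 0 1)"

end

theory Submission
  imports Defs
begin

text \<open>The theorem reduces to one fact about a single convex polyhedron \<open>P\<close> in a product space:
  its fibres \<open>P\<^sub>y = {x. (y, x) \<in> P}\<close> depend on \<open>y\<close> in a Lipschitz manner on the projection
  \<open>fst ` P\<close>, and this projection is closed (lemma \<open>polyhedron_fibres_lipschitz\<close>).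

  Granting this, write \<open>gph S\<close> as a finite union of convex polyhedra and take \<open>\<kappa>\<close> above all their
  Lipschitz constants. Near \<open>ybar\<close> only those pieces matter whose projection contains \<open>ybar\<close>, since
  the other projections are closed sets missing \<open>ybar\<close>; for the pieces that remain, the Lipschitz
  property moves any \<open>x \<in> S y\<close> to a point of \<open>S ybar\<close>, which is calmness. For inner calmness*, a
  single piece has infinitely many \<open>y k\<close> in its projection, hence also the limit \<open>ybar\<close>. Any point
  \<open>xbar\<close> of the fibre over \<open>ybar\<close> can then be moved, by the same Lipschitz property, into the fibres
  over these \<open>y k\<close>.

  The Lipschitz property is a form of Hoffman's error bound. It is obtained here from
  Fourier--Motzkin elimination: eliminating one direction \<open>e\<close> from the inequalities of \<open>P\<close> gives an
  explicit finite system for the shadow \<open>P + span {e}\<close>, and a point of the shadow that lies within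
  distance \<open>d\<close> of a point of \<open>P\<close> returns to \<open>P\<close> by a move along \<open>e\<close> of length \<open>O(d)\<close>. Eliminating
  the directions of the second factor one after the other composes these bounds.\<close>

section \<open>Elimination of one direction\<close>

lemma exists_real_between_finite_sets:
  fixes L U :: "real set"
  assumes "finite L" "finite U" and le: "\<And>l u. l \<in> L \<Longrightarrow> u \<in> U \<Longrightarrow> l \<le> u"
  obtains t where "\<And>l. l \<in> L \<Longrightarrow> l \<le> t" "\<And>u. u \<in> U \<Longrightarrow> t \<le> u"
proof (cases "L = {}")
  case True
  show thesis
  proof (cases "U = {}")
    case True
    with \<open>L = {}\<close> show thesis using that by blast
  next
    case False
    with \<open>L = {}\<close> \<open>finite U\<close> show thesis using that[of "Min U"] by simp
  qed
next
  case False
  with \<open>finite L\<close> show thesis using that[of "Max L"] le by simp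
qed

text \<open>Fourier--Motzkin elimination: the points \<open>q + t *\<^sub>R e\<close> satisfying the inequalities are
  described by lower bounds on \<open>t\<close> (from \<open>a h \<bullet> e < 0\<close>) and upper bounds (from \<open>a h \<bullet> e > 0\<close>), so
  a suitable \<open>t\<close> exists as soon as every lower bound is below every upper bound. Clearing the
  denominators turns each of these comparisons into a linear inequality in \<open>q\<close>.\<close>

lemma fourier_motzkin_elimination:
  fixes a :: "'i \<Rightarrow> 'a::real_inner" and b :: "'i \<Rightarrow> real"
  assumes "finite I"
  shows "(\<exists>t. \<forall>h\<in>I. a h \<bullet> (q + t *\<^sub>R e) \<le> b h) \<longleftrightarrow>
    (\<forall>h\<in>I. a h \<bullet> e = 0 \<longrightarrow> a h \<bullet> q \<le> b h) \<and>
    (\<forall>h\<in>I. \<forall>k\<in>I. a h \<bullet> e < 0 \<and> 0 < a k \<bullet> e \<longrightarrow>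
       ((a k \<bullet> e) *\<^sub>R a h - (a h \<bullet> e) *\<^sub>R a k) \<bullet> q \<le> (a k \<bullet> e) * b h - (a h \<bullet> e) * b k)"
    (is "?L \<longleftrightarrow> ?Z \<and> ?N")
proof
  assume ?L
  then obtain t where t: "\<And>h. h \<in> I \<Longrightarrow> a h \<bullet> q + t * (a h \<bullet> e) \<le> b h"
    by (auto simp: inner_add_right)
  have ?Z
  proof (intro ballI impI)
    fix h assume "h \<in> I" "a h \<bullet> e = 0"
    then show "a h \<bullet> q \<le> b h" using t[of h] by simp
  qed
  moreover have ?N
  proof (intro ballI impI)
    fix h k assume "h \<in> I" "k \<in> I" and s: "a h \<bullet> e < 0 \<and> 0 < a k \<bullet> e"
    have "(a k \<bullet> e) * (a h \<bullet> q + t * (a h \<bullet> e)) \<le> (a k \<bullet> e) * b h"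
      using t[OF \<open>h \<in> I\<close>] s by (intro mult_left_mono) auto
    moreover have "- (a h \<bullet> e) * (a k \<bullet> q + t * (a k \<bullet> e)) \<le> - (a h \<bullet> e) * b k"
      using t[OF \<open>k \<in> I\<close>] s by (intro mult_left_mono) auto
    ultimately show "((a k \<bullet> e) *\<^sub>R a h - (a h \<bullet> e) *\<^sub>R a k) \<bullet> q \<le> (a k \<bullet> e) * b h - (a h \<bullet> e) * b k"
      by (simp add: inner_diff_left algebra_simps)
  qed
  ultimately show "?Z \<and> ?N" ..
next
  assume R: "?Z \<and> ?N"
  define f where "f h = (b h - a h \<bullet> q) / (a h \<bullet> e)" for h
  have le: "l \<le> u" if "l \<in> f ` {h \<in> I. a h \<bullet> e < 0}" "u \<in> f ` {h \<in> I. 0 < a h \<bullet> e}" for l u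
  proof -
    from that obtain h k where hk: "h \<in> I" "k \<in> I" "a h \<bullet> e < 0" "0 < a k \<bullet> e"
      and lu: "l = f h" "u = f k" by auto
    from R hk have "((a k \<bullet> e) *\<^sub>R a h - (a h \<bullet> e) *\<^sub>R a k) \<bullet> q \<le> (a k \<bullet> e) * b h - (a h \<bullet> e) * b k"
      by blast
    then have "(a h \<bullet> e) * (b k - a k \<bullet> q) \<le> (a k \<bullet> e) * (b h - a h \<bullet> q)"
      by (simp add: inner_diff_left algebra_simps)
    with hk show ?thesis
      unfolding lu f_def by (simp add: divide_simps mult.commute)
  qed
  have "finite (f ` {h \<in> I. a h \<bullet> e < 0})" "finite (f ` {h \<in> I. 0 < a h \<bullet> e})"
    using \<open>finite I\<close> by simp_all
  then obtain t where lower: "\<And>l. l \<in> f ` {h \<in> I. a h \<bullet> e < 0} \<Longrightarrow> l \<le> t"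
    and upper: "\<And>u. u \<in> f ` {h \<in> I. 0 < a h \<bullet> e} \<Longrightarrow> t \<le> u"
    using exists_real_between_finite_sets[OF _ _ le] by blast
  have "a h \<bullet> (q + t *\<^sub>R e) \<le> b h" if "h \<in> I" for h
  proof (rule linorder_cases[of "a h \<bullet> e" 0])
    assume "a h \<bullet> e < 0"
    then have "f h \<le> t" using lower that by blast
    with \<open>a h \<bullet> e < 0\<close> show ?thesis
      by (simp add: f_def inner_add_right field_simps)
  next
    assume "a h \<bullet> e = 0"
    then show ?thesis using R that by (simp add: inner_add_right)
  next
    assume "a h \<bullet> e > 0"
    then have "t \<le> f h" using upper that by blast
    with \<open>a h \<bullet> e > 0\<close> show ?thesis
      by (simp add: f_def inner_add_right field_simps)
  qed
  then show ?L by blast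
qed

lemma polyhedron_halfspaces:
  fixes P :: "'a::euclidean_space set"
  assumes "polyhedron P"
  obtains F :: "'a set set" and a b
  where "finite F" "P = {q. \<forall>h\<in>F. a h \<bullet> q \<le> b h}"
proof -
  from assms obtain F where F: "finite F" "P = \<Inter>F"
    and "\<forall>h\<in>F. \<exists>a b. a \<noteq> 0 \<and> h = {x. a \<bullet> x \<le> b}"
    unfolding polyhedron_def by blast
  then obtain a b where h: "\<And>h. h \<in> F \<Longrightarrow> h = {x. a h \<bullet> x \<le> b h}" by metis
  have "P = {q. \<forall>h\<in>F. a h \<bullet> q \<le> b h}"
    using F(2) h by blast
  then show thesis by (rule that[OF F(1)])
qed

lemma polyhedron_shadow_direction:
  fixes P :: "'a::euclidean_space set"
  assumes "polyhedron P"
  shows "polyhedron {q. \<exists>t. q + t *\<^sub>R e \<in> P}"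
proof -
  obtain F :: "'a set set" and a b where F: "finite F" and P: "P = {q. \<forall>h\<in>F. a h \<bullet> q \<le> b h}"
    using polyhedron_halfspaces[OF assms] .
  let ?H = "\<lambda>h. {q. a h \<bullet> q \<le> b h}"
  let ?G = "\<lambda>(h, k). {q. ((a k \<bullet> e) *\<^sub>R a h - (a h \<bullet> e) *\<^sub>R a k) \<bullet> q \<le> (a k \<bullet> e) * b h - (a h \<bullet> e) * b k}"
  let ?Z = "?H ` {h \<in> F. a h \<bullet> e = 0}"
  let ?N = "?G ` {(h, k) \<in> F \<times> F. a h \<bullet> e < 0 \<and> 0 < a k \<bullet> e}"
  have "{q. \<exists>t. q + t *\<^sub>R e \<in> P} = \<Inter>(?Z \<union> ?N)"
  proof (rule set_eqI)
    fix q
    have "q \<in> {q. \<exists>t. q + t *\<^sub>R e \<in> P} \<longleftrightarrow> (\<exists>t. \<forall>h\<in>F. a h \<bullet> (q + t *\<^sub>R e) \<le> b h)"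
      by (simp add: P)
    also have "\<dots> \<longleftrightarrow> q \<in> \<Inter>(?Z \<union> ?N)"
      unfolding fourier_motzkin_elimination[OF F] Inter_Un_distrib Int_iff INT_iff by blast
    finally show "q \<in> {q. \<exists>t. q + t *\<^sub>R e \<in> P} \<longleftrightarrow> q \<in> \<Inter>(?Z \<union> ?N)" .
  qed
  moreover have "finite ?N"
    by (intro finite_imageI finite_subset[OF _ finite_cartesian_product[OF F F]]) auto
  then have "polyhedron (\<Inter>(?Z \<union> ?N))"
    using F by (intro polyhedron_Inter) (auto simp: polyhedron_halfspace_le)
  ultimately show ?thesis by simp
qed

text \<open>At \<open>q\<close> each inequality of \<open>P\<close> is violated by at most \<open>O(norm (q - p))\<close>, because it holds at \<open>p\<close>.
  Hence every lower bound on the admissible \<open>t\<close> is at most \<open>r = L * norm (q - p)\<close> and every upper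
  bound at least \<open>- r\<close>, so truncating any admissible \<open>t\<close> to \<open>[- r, r]\<close> keeps it admissible.\<close>

lemma polyhedron_shadow_direction_lift:
  fixes P :: "'a::euclidean_space set"
  assumes "polyhedron P"
  obtains \<kappa> where "\<kappa> \<ge> 0"
    "\<And>p q s. p \<in> P \<Longrightarrow> q + s *\<^sub>R e \<in> P \<Longrightarrow> \<exists>t. q + t *\<^sub>R e \<in> P \<and> norm (q + t *\<^sub>R e - p) \<le> \<kappa> * norm (q - p)"
proof -
  obtain F :: "'a set set" and a b where F: "finite F" and P: "P = {q. \<forall>h\<in>F. a h \<bullet> q \<le> b h}"
    using polyhedron_halfspaces[OF assms] .
  define L where "L = (\<Sum>h\<in>F. norm (a h) / \<bar>a h \<bullet> e\<bar>)"
  have "L \<ge> 0" unfolding L_def by (intro sum_nonneg) simp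
  have L: "norm (a h) \<le> L * \<bar>a h \<bullet> e\<bar>" if "h \<in> F" "a h \<bullet> e \<noteq> 0" for h
  proof -
    have "norm (a h) / \<bar>a h \<bullet> e\<bar> \<le> L"
      unfolding L_def using F that by (intro member_le_sum) auto
    with that show ?thesis by (simp add: field_simps)
  qed
  have "\<exists>t. q + t *\<^sub>R e \<in> P \<and> norm (q + t *\<^sub>R e - p) \<le> (1 + L * norm e) * norm (q - p)"
    if p: "p \<in> P" and q: "q + s *\<^sub>R e \<in> P" for p q s
  proof (intro exI conjI)
    define r where "r = L * norm (q - p)"
    have "r \<ge> 0" unfolding r_def using \<open>L \<ge> 0\<close> by simp
    define t where "t = max (- r) (min r s)"
    have "a h \<bullet> (q + t *\<^sub>R e) \<le> b h" if "h \<in> F" for h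
    proof -
      have hs: "a h \<bullet> q + s * (a h \<bullet> e) \<le> b h"
        using q that by (simp add: P inner_add_right)
      have ap: "a h \<bullet> p \<le> b h" using p that by (simp add: P)
      have viol: "a h \<bullet> q \<le> b h + r * \<bar>a h \<bullet> e\<bar>" if "a h \<bullet> e \<noteq> 0"
      proof -
        have "a h \<bullet> (q - p) \<le> norm (a h) * norm (q - p)"
          by (rule norm_cauchy_schwarz)
        also have "\<dots> \<le> (L * \<bar>a h \<bullet> e\<bar>) * norm (q - p)"
          using L[OF \<open>h \<in> F\<close> that] by (intro mult_right_mono) auto
        finally show ?thesis using ap by (simp add: inner_diff_right r_def algebra_simps)
      qed
      show ?thesis
      proof (rule linorder_cases[of "a h \<bullet> e" 0])
        assume neg: "a h \<bullet> e < 0"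
        have "t \<ge> r \<or> t \<ge> s" unfolding t_def by auto
        then have "t * (a h \<bullet> e) \<le> r * (a h \<bullet> e) \<or> t * (a h \<bullet> e) \<le> s * (a h \<bullet> e)"
          using neg by (auto intro: mult_right_mono_neg)
        moreover have "a h \<bullet> q \<le> b h - r * (a h \<bullet> e)" using viol neg by simp
        ultimately show ?thesis using hs unfolding inner_add_right inner_scaleR_right by linarith
      next
        assume "a h \<bullet> e = 0"
        then show ?thesis using hs by (simp add: inner_add_right)
      next
        assume pos: "a h \<bullet> e > 0"
        have "t \<le> - r \<or> t \<le> s" unfolding t_def by auto
        then have "t * (a h \<bullet> e) \<le> - r * (a h \<bullet> e) \<or> t * (a h \<bullet> e) \<le> s * (a h \<bullet> e)"
          using pos by (meson mult_right_mono less_imp_le)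
        moreover have "a h \<bullet> q \<le> b h + r * (a h \<bullet> e)" using viol pos by simp
        ultimately show ?thesis using hs unfolding inner_add_right inner_scaleR_right by linarith
      qed
    qed
    then show "q + t *\<^sub>R e \<in> P" by (simp add: P)
    have "\<bar>t\<bar> \<le> r" unfolding t_def using \<open>r \<ge> 0\<close> by auto
    then have "\<bar>t\<bar> * norm e \<le> r * norm e" by (intro mult_right_mono) auto
    moreover have "norm (q + t *\<^sub>R e - p) \<le> norm (q - p) + \<bar>t\<bar> * norm e"
      using norm_triangle_ineq[of "q - p" "t *\<^sub>R e"] by (simp add: algebra_simps)
    ultimately show "norm (q + t *\<^sub>R e - p) \<le> (1 + L * norm e) * norm (q - p)"
      by (simp add: r_def algebra_simps)
  qed
  moreover have "1 + L * norm e \<ge> 0" using \<open>L \<ge> 0\<close> by simp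
  ultimately show thesis using that by blast
qed

section \<open>Elimination of a subspace and Lipschitz fibres\<close>

text \<open>The elimination of one direction iterates: the shadow of \<open>P\<close> along \<open>insert e T\<close> is the shadow
  along \<open>e\<close> of the shadow along \<open>T\<close>, and a point is lifted back first along \<open>e\<close>, then along
  \<open>T\<close>, which multiplies the constants. Both claims are carried along together since the
  lift along \<open>e\<close> requires that the shadow along \<open>T\<close> is again a polyhedron.\<close>

lemma polyhedron_shadow_span:
  fixes P :: "'a::euclidean_space set"
  assumes "finite T" "polyhedron P"
  shows "polyhedron {q. \<exists>v\<in>span T. q + v \<in> P} \<and>
    (\<exists>\<kappa>\<ge>0. \<forall>p\<in>P. \<forall>q. (\<exists>v\<in>span T. q + v \<in> P) \<longrightarrow>
       (\<exists>v\<in>span T. q + v \<in> P \<and> norm (q + v - p) \<le> \<kappa> * norm (q - p)))"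
  using \<open>finite T\<close>
proof (induction T rule: finite_induct)
  case empty
  have "\<exists>\<kappa>\<ge>0::real. \<forall>p\<in>P. \<forall>q. q \<in> P \<longrightarrow> norm (q - p) \<le> \<kappa> * norm (q - p)"
    by (rule exI[of _ 1]) simp
  with assms(2) show ?case by simp
next
  case (insert e T)
  define Q where "Q = {q. \<exists>v\<in>span T. q + v \<in> P}"
  have "polyhedron Q" using insert.IH by (simp add: Q_def)
  obtain \<kappa> where "\<kappa> \<ge> 0" and \<kappa>: "\<And>p q. p \<in> P \<Longrightarrow> q \<in> Q \<Longrightarrow>
      \<exists>v\<in>span T. q + v \<in> P \<and> norm (q + v - p) \<le> \<kappa> * norm (q - p)"
    using insert.IH by (auto simp: Q_def)
  obtain \<mu> where "\<mu> \<ge> 0" and \<mu>: "\<And>p q s. p \<in> Q \<Longrightarrow> q + s *\<^sub>R e \<in> Q \<Longrightarrow>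
      \<exists>t. q + t *\<^sub>R e \<in> Q \<and> norm (q + t *\<^sub>R e - p) \<le> \<mu> * norm (q - p)"
    using polyhedron_shadow_direction_lift[OF \<open>polyhedron Q\<close>] by blast
  have sub: "p \<in> Q" if "p \<in> P" for p
    using that span_zero[of T] unfolding Q_def by force
  have shift: "t *\<^sub>R e + v \<in> span (insert e T)" if "v \<in> span T" for t v
    using that by (auto simp: span_insert intro!: exI[of _ t])
  have shadow: "(\<exists>v\<in>span (insert e T). q + v \<in> P) \<longleftrightarrow> (\<exists>t. q + t *\<^sub>R e \<in> Q)" for q
  proof
    assume "\<exists>v\<in>span (insert e T). q + v \<in> P"
    then obtain v t where "q + v \<in> P" "v - t *\<^sub>R e \<in> span T" by (auto simp: span_insert)
    then have "q + t *\<^sub>R e \<in> Q" unfolding Q_def by (auto intro!: bexI[of _ "v - t *\<^sub>R e"])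
    then show "\<exists>t. q + t *\<^sub>R e \<in> Q" ..
  next
    assume "\<exists>t. q + t *\<^sub>R e \<in> Q"
    then obtain t v where "v \<in> span T" "q + (t *\<^sub>R e + v) \<in> P" by (auto simp: Q_def add.assoc)
    then show "\<exists>v\<in>span (insert e T). q + v \<in> P" using shift by blast
  qed
  have "polyhedron {q. \<exists>v\<in>span (insert e T). q + v \<in> P}"
    unfolding shadow by (rule polyhedron_shadow_direction[OF \<open>polyhedron Q\<close>])
  moreover have "\<exists>v\<in>span (insert e T). q + v \<in> P \<and> norm (q + v - p) \<le> (\<kappa> * \<mu>) * norm (q - p)"
    if "p \<in> P" and q: "\<exists>v\<in>span (insert e T). q + v \<in> P" for p q
  proof -
    obtain s where "q + s *\<^sub>R e \<in> Q" using q shadow by blast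
    then obtain t where t: "q + t *\<^sub>R e \<in> Q" "norm (q + t *\<^sub>R e - p) \<le> \<mu> * norm (q - p)"
      using \<mu> sub[OF \<open>p \<in> P\<close>] by blast
    obtain v where v: "v \<in> span T" "q + t *\<^sub>R e + v \<in> P"
      "norm (q + t *\<^sub>R e + v - p) \<le> \<kappa> * norm (q + t *\<^sub>R e - p)"
      using \<kappa>[OF \<open>p \<in> P\<close> t(1)] by blast
    note v(3)
    also have "\<kappa> * norm (q + t *\<^sub>R e - p) \<le> \<kappa> * (\<mu> * norm (q - p))"
      using t(2) \<open>\<kappa> \<ge> 0\<close> by (rule mult_left_mono)
    finally show ?thesis using shift[OF v(1), of t] v(2)
      by (auto simp: add.assoc mult.assoc intro!: bexI[of _ "t *\<^sub>R e + v"])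
  qed
  moreover have "\<kappa> * \<mu> \<ge> 0" using \<open>\<kappa> \<ge> 0\<close> \<open>\<mu> \<ge> 0\<close> by simp
  ultimately show ?case by blast
qed

text \<open>This is the previous lemma for the vertical directions \<open>{0} \<times> UNIV\<close>: given \<open>(y, x) \<in> P\<close> and a
  second base point \<open>y'\<close>, the point \<open>(y', x)\<close> lies in the vertical shadow of \<open>P\<close> and has distance
  \<open>norm (y' - y)\<close> from \<open>(y, x)\<close>.\<close>

lemma polyhedron_fibres_lipschitz:
  fixes P :: "('a::euclidean_space \<times> 'b::euclidean_space) set"
  assumes "polyhedron P"
  shows "closed (fst ` P)"
    and "\<exists>\<kappa>\<ge>0. \<forall>y x. (y, x) \<in> P \<longrightarrow> (\<forall>y'\<in>fst ` P. \<exists>x'. (y', x') \<in> P \<and> norm (x' - x) \<le> \<kappa> * norm (y' - y))"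
proof -
  let ?T = "Pair (0::'a) ` (Basis :: 'b set)"
  have "linear (Pair (0::'a) :: 'b \<Rightarrow> 'a \<times> 'b)"
    by (rule linearI) auto
  then have span: "span ?T = range (Pair 0)"
    by (simp add: linear_span_image)
  have shadow: "(\<exists>v\<in>span ?T. (y, x) + v \<in> P) \<longleftrightarrow> y \<in> fst ` P" for y x
  proof
    assume "y \<in> fst ` P"
    then obtain x' where "(y, x') \<in> P" by auto
    then show "\<exists>v\<in>span ?T. (y, x) + v \<in> P"
      unfolding span by (intro bexI[of _ "(0, x' - x)"]) auto
  next
    assume "\<exists>v\<in>span ?T. (y, x) + v \<in> P"
    then obtain z where "(y, x + z) \<in> P" unfolding span by auto
    then show "y \<in> fst ` P" by (rule image_eqI[rotated]) simp
  qed
  have "finite ?T" by simp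
  note main = polyhedron_shadow_span[OF this assms]
  have "closed {q. \<exists>v\<in>span ?T. q + v \<in> P}"
    using main by (intro polyhedron_imp_closed) (rule conjunct1)
  then have "closed ((\<lambda>y. (y, 0)) -` {q. \<exists>v\<in>span ?T. q + v \<in> P})"
    by (intro continuous_closed_vimage continuous_intros)
  then show "closed (fst ` P)"
    by (simp only: vimage_def mem_Collect_eq shadow Collect_mem_eq)
  obtain \<kappa> where "\<kappa> \<ge> 0" and \<kappa>: "\<And>p q. p \<in> P \<Longrightarrow> \<exists>v\<in>span ?T. q + v \<in> P \<Longrightarrow>
      \<exists>v\<in>span ?T. q + v \<in> P \<and> norm (q + v - p) \<le> \<kappa> * norm (q - p)"
    using conjunct2[OF main] by blast
  have "\<exists>x'. (y', x') \<in> P \<and> norm (x' - x) \<le> \<kappa> * norm (y' - y)"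
    if "(y, x) \<in> P" "y' \<in> fst ` P" for y x y'
  proof -
    have "\<exists>v\<in>span ?T. (y', x) + v \<in> P \<and> norm ((y', x) + v - (y, x)) \<le> \<kappa> * norm ((y', x) - (y, x))"
      using that shadow by (intro \<kappa>) auto
    then obtain z where z: "(y', x + z) \<in> P" "norm (y' - y, z) \<le> \<kappa> * norm (y' - y, 0::'b)"
      by (auto simp: span)
    note norm_snd_le[of z "y' - y"]
    also note z(2)
    finally have "norm z \<le> \<kappa> * norm (y' - y)" by (simp add: norm_Pair)
    with z(1) show ?thesis by (intro exI[of _ "x + z"]) simp
  qed
  with \<open>\<kappa> \<ge> 0\<close> show "\<exists>\<kappa>\<ge>0. \<forall>y x. (y, x) \<in> P \<longrightarrow> (\<forall>y'\<in>fst ` P. \<exists>x'. (y', x') \<in> P \<and> norm (x' - x) \<le> \<kappa> * norm (y' - y))"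
    by blast
qed

section \<open>Polyhedral maps\<close>

theorem theorem3p4:
  fixes S :: "real ^ 'm \<Rightarrow> (real ^ 'n) set"
  assumes "polyhedral_map S"
  shows "\<exists>\<kappa>>0. \<forall>ybar\<in>svdom S.
           inner_calm_star S (svdom S) \<kappa> ybar \<and> calm_nonlocal S \<kappa> ybar"
proof -
  obtain F where F: "finite F" "\<And>P. P \<in> F \<Longrightarrow> polyhedron P" and gph: "gph S = \<Union>F"
    using assms unfolding polyhedral_map_def polyhedral_set_def by blast
  have S: "x \<in> S y \<longleftrightarrow> (\<exists>P\<in>F. (y, x) \<in> P)" for x y
    using gph by (auto simp: gph_def set_eq_iff)
  have closed: "closed (fst ` P)" if "P \<in> F" for P
    using polyhedron_fibres_lipschitz(1) F(2) that by blast
  have "\<forall>P\<in>F. \<exists>\<kappa>\<ge>0. \<forall>y x. (y, x) \<in> P \<longrightarrow>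
      (\<forall>y'\<in>fst ` P. \<exists>x'. (y', x') \<in> P \<and> norm (x' - x) \<le> \<kappa> * norm (y' - y))"
    using polyhedron_fibres_lipschitz(2) F(2) by blast
  then obtain c where c0: "\<And>P. P \<in> F \<Longrightarrow> c P \<ge> 0"
    and c: "\<And>P y x y'. P \<in> F \<Longrightarrow> (y, x) \<in> P \<Longrightarrow> y' \<in> fst ` P \<Longrightarrow>
      \<exists>x'. (y', x') \<in> P \<and> norm (x' - x) \<le> c P * norm (y' - y)"
    by metis
  define \<kappa> where "\<kappa> = 1 + sum c F"
  have "\<kappa> > 0" unfolding \<kappa>_def using c0 by (simp add: add_pos_nonneg sum_nonneg)
  have lip: "\<exists>x'. (y', x') \<in> P \<and> norm (x' - x) \<le> \<kappa> * norm (y' - y)"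
    if "P \<in> F" "(y, x) \<in> P" "y' \<in> fst ` P" for P y x y'
  proof -
    have "c P \<le> \<kappa>" unfolding \<kappa>_def using member_le_sum[of P F c] c0 F(1) that(1) by force
    then have "c P * norm (y' - y) \<le> \<kappa> * norm (y' - y)" by (rule mult_right_mono) simp
    with c[OF that] show ?thesis by (meson order_trans)
  qed
  have "inner_calm_star S (svdom S) \<kappa> ybar" for ybar
    unfolding inner_calm_star_def
  proof (intro allI impI)
    fix y :: "nat \<Rightarrow> real ^ 'm"
    assume "(\<forall>k. y k \<in> svdom S) \<and> y \<longlonglongrightarrow> ybar"
    then have dom: "\<And>k. \<exists>x. x \<in> S (y k)" and lim: "y \<longlonglongrightarrow> ybar"
      by (auto simp: svdom_def)
    have "(\<Union>P\<in>F. {k. y k \<in> fst ` P}) = UNIV"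
      using dom S by force
    then obtain P where P: "P \<in> F" and inf: "infinite {k. y k \<in> fst ` P}"
      using F(1) by (metis finite_UN_I infinite_UNIV_nat)
    have freq: "\<exists>\<^sub>F k in sequentially. y k \<in> fst ` P"
      using inf by (simp add: cofinite_eq_sequentially[symmetric] frequently_cofinite)
    have "ybar \<in> fst ` P"
    proof (rule ccontr)
      assume "ybar \<notin> fst ` P"
      then have "\<forall>\<^sub>F k in sequentially. y k \<in> - fst ` P"
        using closed[OF P] by (intro topological_tendstoD[OF lim]) auto
      with freq show False by (auto simp: frequently_def)
    qed
    then obtain xbar where xbar: "(ybar, xbar) \<in> P" by auto
    have "\<forall>k\<in>{k. y k \<in> fst ` P}. \<exists>x. x \<in> S (y k) \<and> norm (x - xbar) \<le> \<kappa> * norm (y k - ybar)"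
      using lip[OF P xbar] S P by blast
    then obtain x where "\<forall>k\<in>{k. y k \<in> fst ` P}. x k \<in> S (y k) \<and> norm (x k - xbar) \<le> \<kappa> * norm (y k - ybar)"
      by metis
    with inf show "\<exists>(K::nat set) (x::nat \<Rightarrow> real ^ 'n) xbar. infinite K \<and>
        (\<forall>k\<in>K. x k \<in> S (y k) \<and> norm (x k - xbar) \<le> \<kappa> * norm (y k - ybar))"
      by blast
  qed
  moreover have "calm_nonlocal S \<kappa> ybar" for ybar
    unfolding calm_nonlocal_def
  proof -
    have "\<forall>\<^sub>F y in nhds ybar. \<forall>P\<in>F. ybar \<notin> fst ` P \<longrightarrow> y \<notin> fst ` P"
    proof (intro eventually_ball_finite[OF F(1)] ballI)
      fix P assume "P \<in> F"
      show "\<forall>\<^sub>F y in nhds ybar. ybar \<notin> fst ` P \<longrightarrow> y \<notin> fst ` P"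
      proof (cases "ybar \<in> fst ` P")
        case False
        with closed[OF \<open>P \<in> F\<close>] have "\<forall>\<^sub>F y in nhds ybar. y \<in> - fst ` P"
          by (intro eventually_nhds_in_open) auto
        then show ?thesis by (rule eventually_mono) simp
      qed simp
    qed
    then show "\<forall>\<^sub>F y in nhds ybar. S y \<subseteq> S ybar + (\<lambda>b. (\<kappa> * norm (y - ybar)) *\<^sub>R b) ` cball 0 1"
    proof (rule eventually_mono, intro subsetI)
      fix y x
      assume near: "\<forall>P\<in>F. ybar \<notin> fst ` P \<longrightarrow> y \<notin> fst ` P" and "x \<in> S y"
      then obtain P where P: "P \<in> F" "(y, x) \<in> P" using S by blast
      then have "y \<in> fst ` P" by force
      with near P(1) have "ybar \<in> fst ` P" by blast
      from lip[OF P this] obtain x' where x': "x' \<in> S ybar" "norm (x' - x) \<le> \<kappa> * norm (ybar - y)"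
        using S P(1) by blast
      define r where "r = \<kappa> * norm (y - ybar)"
      have r: "norm (x - x') \<le> r" using x'(2) by (simp add: r_def norm_minus_commute)
      \<comment> \<open>For \<open>r = 0\<close> the vector below is \<open>0\<close>, which is correct since then \<open>x = x'\<close>.\<close>
      have "x - x' = r *\<^sub>R ((x - x') /\<^sub>R r)" "(x - x') /\<^sub>R r \<in> cball 0 1"
        using r norm_ge_zero[of "x - x'"] by (auto simp: divide_simps)
      then have "x - x' \<in> (\<lambda>b. r *\<^sub>R b) ` cball 0 1" by blast
      from set_plus_intro[OF x'(1) this]
      show "x \<in> S ybar + (\<lambda>b. (\<kappa> * norm (y - ybar)) *\<^sub>R b) ` cball 0 1"
        by (simp add: r_def)
    qed
  qed
  ultimately show ?thesis using \<open>\<kappa> > 0\<close> by blast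
qed

end
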